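(* Consider the two-queue, single-server system with one-slot switchover delay and memoryless channels: the variables $C_i(t)$, $i\in\{1,2\}$, $t\ge 0$, are i.i.d. over time, independent across queues, and equal to $1$ with probability $0.5$ and $0$ with probability $0.5$. Then the stability region is $$\mathbf{\Lambda}=\{(\lambda_1,\lambda_2)\ :\ \lambda_1+\lambda_2\le 0.5,\ \lambda_1,\lambda_2\ge 0\}.$$ In addition, the Exhaustive (Gated) policy is throughput-optimal.
   Context: Time is slotted, $t\in\{0,1,2,\dots\}$. There are two queues and one server; $m(t)\in\{1,2\}$ is the queue at which the server is present in slot $t$. The numbers $A_i(t)$ of packets arriving to queue $i$ in slot $t$ are i.i.d. over $t$, nonnegative integer valued, with mean $\lambda_i$ and $\mathbb{E}[A_i^2(t)]\le A_{\max}^2<\infty$. $C_i(t)\in\{0,1\}$ is the channel state of queue $i$ in slot $t$ ($1$ = ON, $0$ = OFF). The processes $A_1,A_2,C_1,C_2$ are independent. At the beginning of each slot the server knows the queue lengths $Q_1(t),Q_2(t)$ and the channel states $(C_1(t),C_2(t))$ and chooses $a_t=1$ (stay, so $m(t+1)=m(t)$) or $a_t=0$ (switch, so $m(t+1)$ is the other queue; the switch takes the whole slot $t$). One packet is served from queue $i$ in slot $t$ (if it is nonempty) if and only if $m(t)=i$, $a_t=1$ and $C_i(t)=1$. Queues evolve as $Q_i(t+1)=\max(Q_i(t)-D_i(t),0)+A_i(t)$, where $D_i(t)\in\{0,1\}$ indicates whether such a service opportunity is given to queue $i$ in slot $t$, and $Q_i(0)=0$. Policies may be history-dependent and randomized (non-anticipating).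 The system is stable under a policy if $\limsup_{t\to\infty}\frac1t\sum_{\tau=0}^{t-1}\sum_{i}\mathbb{E}[Q_i(\tau)]<\infty$. The stability region $\mathbf{\Lambda}$ is the (closure of the) set of all arrival rate vectors $(\lambda_1,\lambda_2)$ for which there exists a policy that stabilizes the system. A policy is throughput-optimal if it stabilizes the system for all arrival rate vectors strictly inside $\mathbf{\Lambda}$, i.e. for all $\boldsymbol\lambda\in\rho\mathbf{\Lambda}$ with some $0\le\rho<1$. Gated policy: the server visits the queues in cyclic order; in each visit to a queue it stays until it has served exactly the packets that were present in that queue when the server arrived there, and then switches to the next queue. (The Exhaustive policy instead stays until the queue is empty.) *)

theory Defs
  imports "HOL-Probability.Probability" "HOL-Library.Monad_Syntax"
begin

text \<open>
  Queues are indexed by the two-element numeral type \<open>2\<close> (elements \<open>1\<close> and \<open>2\<close>), and arrival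
  rate vectors live in \<open>real ^ 2\<close>. All one-slot quantities are discrete, so the controlled system
  is given by the law, for each \<open>t\<close>, of the trajectory up to the beginning of slot \<open>t\<close>.
\<close>

datatype state = State (qlen: "2 \<Rightarrow> nat") (loc: 2)

type_synonym channels = "2 \<Rightarrow> bool"

text \<open>Past slots (state, channels, action), most recent first; the action \<open>True\<close> means ``stay''.\<close>
type_synonym past = "(state \<times> channels \<times> bool) list"

text \<open>
  A policy maps what the server knows at the beginning of a slot, namely the past and the current
  state and channels but not the arrivals of the slot, to a distribution of the action.
\<close>
type_synonym policy = "past \<Rightarrow> state \<Rightarrow> channels \<Rightarrow> bool pmf"

definition other :: "2 \<Rightarrow> 2" where
  "other i = (if i = 1 then 2 else 1)"

definition service :: "state \<Rightarrow> channels \<Rightarrow> bool \<Rightarrow> 2 \<Rightarrow> nat" where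
  "service s c a i = of_bool (loc s = i \<and> a \<and> c i)"

text \<open>Subtraction on \<open>nat\<close> truncates, so \<open>qlen s i - service s c a i\<close> is \<open>max (Q - D) 0\<close>.\<close>
definition step :: "state \<Rightarrow> channels \<Rightarrow> bool \<Rightarrow> (2 \<Rightarrow> nat) \<Rightarrow> state" where
  "step s c a A = State (\<lambda>i. qlen s i - service s c a i + A i) (if a then loc s else other (loc s))"

text \<open>
  \<open>arr i\<close> and \<open>ch i\<close> are the one-slot laws of \<open>A\<^sub>i(t)\<close> and \<open>C\<^sub>i(t)\<close>. Drawing all of them afresh from
  product distributions in every slot makes them i.i.d. over time and independent of each other.
  The defaults of \<open>Pi_pmf\<close> play no role because the index set is \<open>UNIV\<close>.
\<close>
primrec trajectory ::
    "(2 \<Rightarrow> nat pmf) \<Rightarrow> (2 \<Rightarrow> bool pmf) \<Rightarrow> 2 \<Rightarrow> policy \<Rightarrow> nat \<Rightarrow> (past \<times> state) pmf" where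
  "trajectory arr ch m0 \<pi> 0 = return_pmf ([], State (\<lambda>_. 0) m0)"
| "trajectory arr ch m0 \<pi> (Suc t) = do {
     (h, s) \<leftarrow> trajectory arr ch m0 \<pi> t;
     c \<leftarrow> Pi_pmf UNIV False ch;
     a \<leftarrow> \<pi> h s c;
     A \<leftarrow> Pi_pmf UNIV 0 arr;
     return_pmf ((s, c, a) # h, step s c a A)
   }"

definition mean_qlen ::
    "(2 \<Rightarrow> nat pmf) \<Rightarrow> (2 \<Rightarrow> bool pmf) \<Rightarrow> 2 \<Rightarrow> policy \<Rightarrow> nat \<Rightarrow> 2 \<Rightarrow> ennreal" where
  "mean_qlen arr ch m0 \<pi> t i = (\<integral>\<^sup>+ x. of_nat (qlen (snd x) i) \<partial>trajectory arr ch m0 \<pi> t)"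

definition stabilizes :: "(2 \<Rightarrow> nat pmf) \<Rightarrow> (2 \<Rightarrow> bool pmf) \<Rightarrow> 2 \<Rightarrow> policy \<Rightarrow> bool" where
  "stabilizes arr ch m0 \<pi> \<longleftrightarrow>
     limsup (\<lambda>t. (\<Sum>\<tau><t. \<Sum>i\<in>UNIV. mean_qlen arr ch m0 \<pi> \<tau> i) / of_nat t) < \<infinity>"

definition arrival_law :: "real \<Rightarrow> nat pmf \<Rightarrow> bool" where
  "arrival_law x p \<longleftrightarrow>
     integrable (measure_pmf p) (\<lambda>k. (real k)\<^sup>2) \<and> measure_pmf.expectation p real = x"

text \<open>
  A rate vector does not determine the arrival laws. The function \<open>F\<close> selects, for every rate vector
  \<open>r\<close>, laws \<open>F r 1\<close> and \<open>F r 2\<close> with means \<open>r $ 1\<close> and \<open>r $ 2\<close>; its values at vectors with a negative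
  entry are irrelevant.
\<close>
definition arrival_model :: "(real ^ 2 \<Rightarrow> 2 \<Rightarrow> nat pmf) \<Rightarrow> bool" where
  "arrival_model F \<longleftrightarrow> (\<forall>r. (\<forall>i. 0 \<le> r $ i) \<longrightarrow> (\<forall>i. arrival_law (r $ i) (F r i)))"

definition stability_region ::
    "(real ^ 2 \<Rightarrow> 2 \<Rightarrow> nat pmf) \<Rightarrow> (2 \<Rightarrow> bool pmf) \<Rightarrow> 2 \<Rightarrow> (real ^ 2) set" where
  "stability_region F ch m0 =
     closure {r. (\<forall>i. 0 \<le> r $ i) \<and> (\<exists>\<pi>. stabilizes (F r) ch m0 \<pi>)}"

definition throughput_optimal ::
    "(real ^ 2 \<Rightarrow> 2 \<Rightarrow> nat pmf) \<Rightarrow> (2 \<Rightarrow> bool pmf) \<Rightarrow> 2 \<Rightarrow> policy \<Rightarrow> bool" where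
  "throughput_optimal F ch m0 \<pi> \<longleftrightarrow>
     (\<forall>\<rho> r. 0 \<le> \<rho> \<and> \<rho> < 1 \<and> r \<in> (*\<^sub>R) \<rho> ` stability_region F ch m0 \<longrightarrow>
        stabilizes (F r) ch m0 \<pi>)"

definition exhaustive :: policy where
  "exhaustive h s c = return_pmf (0 < qlen s (loc s))"

text \<open>
  \<open>gate h s\<close> is the number of packets that were present in the queue of the server when the current
  visit began and that have not been served yet. A visit begins in slot \<open>0\<close> and after each switch.
\<close>
primrec gate :: "past \<Rightarrow> state \<Rightarrow> nat" where
  "gate [] s = qlen s (loc s)"
| "gate (x # h) s =
     (case x of (s', c, a) \<Rightarrow>
        if a then gate h s' - service s' c a (loc s') else qlen s (loc s))"

definition gated :: policy where
  "gated h s c = return_pmf (0 < gate h s)"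

end

theory Submission
  imports Defs
begin

text \<open>
  Write \<open>X\<close> for the total number of queued packets and \<open>\<lambda>\<close> for the total arrival rate.

  A service needs an ON channel at the queue of the server. That channel is ON with probability
  \<open>1 / 2\<close> independently of everything that determines the location of the server, so no policy can
  lower the mean of \<open>X\<close> by more than \<open>1 / 2 - \<lambda>\<close> per slot. If \<open>\<lambda> > 1 / 2\<close>, the mean of \<open>X\<close> grows
  at least linearly and so does its time average (\<open>not_stabilizes_if_overloaded\<close>).

  Conversely let \<open>\<delta> = 1 / 2 - \<lambda> > 0\<close>. Both policies give the server a \<^emph>\<open>budget\<close>, a number of
  packets that it still has to serve before it switches: the current queue length for the exhaustive
  policy, the remaining gate for the gated one. While the budget is positive, \<open>X\<close> has drift \<open>-\<delta>\<close>. A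
  switching slot, on the contrary, is idle and \<open>X\<close> has drift \<open>\<lambda> > 0\<close> in it, so \<open>X\<^sup>2\<close> alone
  is not a Lyapunov function. But two consecutive switches cannot both lead to small budgets if
  \<open>X\<close> is large: when the budget is used up, the next budget is at least the length \<open>q\<close> of the other
  queue, and the next two together are at least \<open>X\<close>. A budget of \<open>g\<close>
  packets therefore announces idle slots to come, one after at least \<open>g\<close> services and one more after at
  least \<open>g + q\<close> services. They are charged in advance by
  \<open>V = X\<^sup>2 + 2 X (\<phi>(g) + \<phi>(g + q))\<close> with \<open>\<phi>(n) = 1 / (1 + \<kappa> n)\<close>.
  A service raises each \<open>\<phi>\<close> by at most \<open>\<kappa>\<close>, so for \<open>\<kappa> = \<delta> / 2\<close> half of the negative drift
  survives (\<open>lyapunov_stay\<close>). At a switch, \<open>g = 0\<close>, the bracket is \<open>1 + \<phi>(q)\<close> before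
  and at most \<open>\<phi>(q) + \<phi>(X)\<close> after the slot; since \<open>X \<phi>(X) \<le> 1 / \<kappa>\<close>, the bracket
  pays \<open>2 X\<close> up to a constant, more than the \<open>2 \<lambda> X\<close> that the idle slot costs
  (\<open>lyapunov_switch\<close>). Hence \<open>V\<close> loses \<open>\<delta> X - M\<close> per slot on average (\<open>lyapunov_drift\<close>), and
  telescoping bounds the time average of the mean of \<open>X\<close> by \<open>M / \<delta>\<close>.

  The region is the closure of the stabilizable rates, and scaling a vector with \<open>\<lambda> \<le> 1 / 2\<close> by
  \<open>\<rho> < 1\<close> gives \<open>\<lambda> < 1 / 2\<close>; this settles the boundary and reduces throughput optimality
  to the case \<open>\<delta> > 0\<close>.
\<close>

section \<open>Backlog and its one-slot change\<close>

definition backlog :: "state \<Rightarrow> nat" where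
  "backlog s = (\<Sum>i\<in>UNIV. qlen s i)"

lemma two_queues:
  fixes f :: "2 \<Rightarrow> 'a::comm_monoid_add"
  shows "(\<Sum>i\<in>UNIV. f i) = f i + f (other i)"
proof -
  have "i = 1 \<or> i = 2" by (rule exhaust_2)
  then show ?thesis by (auto simp: sum_2 other_def add.commute)
qed

lemma other_other [simp]: "other (other i) = i"
  using exhaust_2[of i] by (auto simp: other_def)

lemma other_neq [simp]: "other i \<noteq> i" "i \<noteq> other i"
  using exhaust_2[of i] by (auto simp: other_def)

lemma backlog_step_stay:
  assumes "0 < qlen s (loc s)"
  shows "real (backlog (step s c True A))
    = real (backlog s) - of_bool (c (loc s)) + real (\<Sum>i\<in>UNIV. A i)"
  using assms by (auto simp: backlog_def two_queues[where i="loc s"] step_def service_def of_nat_diff)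

lemma backlog_step_switch: "backlog (step s c False A) = backlog s + (\<Sum>i\<in>UNIV. A i)"
  by (auto simp: backlog_def two_queues[where i="loc s"] step_def service_def)

text \<open>
  The bound that no policy can beat: it charges a service to every slot in which the channel at the
  server is ON, whatever the action is and whether or not a packet is waiting.
\<close>
lemma backlog_step_ge: "backlog s + (\<Sum>i\<in>UNIV. A i) \<le> backlog (step s c a A) + of_bool (c (loc s))"
  by (auto simp: backlog_def two_queues[where i="loc s"] step_def service_def)

section \<open>The Lyapunov function\<close>

text \<open>
  The price, per queued packet, of an idle slot that is \<open>n\<close> services away. A rational rather than an
  exponential weight makes both \<open>n * imminence \<kappa> n\<close> and the increments trivially bounded.
\<close>
definition imminence :: "real \<Rightarrow> nat \<Rightarrow> real" where
  "imminence \<kappa> n = 1 / (1 + \<kappa> * real n)"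

lemma imminence_bounds:
  assumes "0 < \<kappa>"
  shows "0 \<le> imminence \<kappa> n" "imminence \<kappa> n \<le> 1" "imminence \<kappa> 0 = 1"
    "real n * imminence \<kappa> n \<le> 1 / \<kappa>"
proof -
  have "0 \<le> \<kappa> * real n" using assms by simp
  then show "0 \<le> imminence \<kappa> n" "imminence \<kappa> n \<le> 1" "imminence \<kappa> 0 = 1"
    "real n * imminence \<kappa> n \<le> 1 / \<kappa>"
    using assms by (simp_all add: imminence_def divide_le_eq field_simps add_pos_nonneg)
qed

lemma imminence_antimono:
  assumes "0 < \<kappa>" "m \<le> n"
  shows "imminence \<kappa> n \<le> imminence \<kappa> m"
  unfolding imminence_def using assms
  by (intro divide_left_mono mult_pos_pos add_pos_nonneg add_left_mono mult_left_mono) auto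

lemma imminence_decrement:
  assumes "0 < \<kappa>" "n \<le> Suc m"
  shows "imminence \<kappa> m \<le> imminence \<kappa> n + \<kappa>"
proof -
  have "imminence \<kappa> m - imminence \<kappa> (Suc m) = \<kappa> / ((1 + \<kappa> * m) * (1 + \<kappa> * Suc m))"
    using assms by (simp add: imminence_def field_simps add_nonneg_eq_0_iff)
  also have "\<dots> \<le> \<kappa> / 1"
    using assms mult_mono[of 1 "1 + \<kappa> * m" 1 "1 + \<kappa> * Suc m"]
    by (intro divide_left_mono) auto
  finally show ?thesis using imminence_antimono[OF assms] by simp
qed

text \<open>
  Here \<open>g\<close> is the budget of the current visit. The next visit starts with a budget of at least
  \<open>qlen s (other (loc s))\<close>, so at least \<open>g + qlen s (other (loc s))\<close> services precede the second
  switch from now.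
\<close>
definition lyapunov :: "real \<Rightarrow> nat \<Rightarrow> state \<Rightarrow> real" where
  "lyapunov \<kappa> g s = (real (backlog s))\<^sup>2
     + 2 * real (backlog s) * (imminence \<kappa> g + imminence \<kappa> (g + qlen s (other (loc s))))"

lemma lyapunov_nonneg: "0 < \<kappa> \<Longrightarrow> 0 \<le> lyapunov \<kappa> g s"
  by (simp add: lyapunov_def imminence_bounds)

text \<open>
  A service lowers the square of the backlog by twice the backlog, up to constants. It also brings
  both switches one service closer, and this takes back the fraction \<open>2 * \<kappa>\<close> of the gain. Arrivals
  can only postpone the switches.
\<close>
lemma lyapunov_stay:
  fixes A :: "2 \<Rightarrow> nat" and c :: channels
  assumes \<kappa>: "0 < \<kappa>" "\<kappa> \<le> 1 / 4" and g: "0 < g" "g \<le> qlen s (loc s)"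
    and g': "g - service s c True (loc s) \<le> g'"
  defines "S \<equiv> real (\<Sum>i\<in>UNIV. A i)" and "D \<equiv> of_bool (c (loc s))"
  shows "lyapunov \<kappa> g' (step s c True A)
    \<le> lyapunov \<kappa> g s + real (backlog s) * (2 * S - (2 - 4 * \<kappa>) * D) + S\<^sup>2 + 5 * S + 1"
proof -
  let ?s' = "step s c True A"
  define X where "X = real (backlog s)"
  define \<Phi> where "\<Phi> = imminence \<kappa> g + imminence \<kappa> (g + qlen s (other (loc s)))"
  define \<Phi>' where "\<Phi>' = imminence \<kappa> g' + imminence \<kappa> (g' + qlen ?s' (other (loc ?s')))"
  have D: "D = 0 \<or> D = 1" and S: "0 \<le> S" by (auto simp: D_def S_def simp del: of_nat_sum)
  have X: "X \<ge> 1"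
    using g by (simp add: X_def backlog_def two_queues[where i="loc s"])
  have X': "real (backlog ?s') = X - D + S"
    using g backlog_step_stay[of s c A] by (simp add: X_def D_def S_def)
  have \<Phi>: "0 \<le> \<Phi>" "\<Phi> \<le> 2"
    using imminence_bounds(1,2)[OF \<kappa>(1), of g]
      imminence_bounds(1,2)[OF \<kappa>(1), of "g + qlen s (other (loc s))"]
    unfolding \<Phi>_def by linarith+
  have "\<Phi>' \<le> \<Phi> + 2 * \<kappa> * D"
  proof (cases "c (loc s)")
    case True
    then have "g \<le> Suc g'" using g' by (simp add: service_def)
    with True show ?thesis
      using imminence_decrement[OF \<kappa>(1), of g g']
        imminence_decrement[OF \<kappa>(1), of "g + qlen s (other (loc s))"
          "g' + qlen ?s' (other (loc ?s'))"] g'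
      by (auto simp: D_def \<Phi>_def \<Phi>'_def step_def service_def)
  next
    case False
    then show ?thesis
      using imminence_antimono[OF \<kappa>(1), of g g']
        imminence_antimono[OF \<kappa>(1), of "g + qlen s (other (loc s))"
          "g' + qlen ?s' (other (loc ?s'))"] g'
      by (auto simp: D_def \<Phi>_def \<Phi>'_def step_def service_def)
  qed
  then have "(X - D + S) * \<Phi>' \<le> (X - D + S) * (\<Phi> + 2 * \<kappa> * D)"
    using X D S by (intro mult_left_mono) auto
  moreover have "S * \<Phi> \<le> S * 2"
    using \<Phi>(2) S by (rule mult_left_mono)
  moreover have "\<kappa> * S \<le> 1 / 4 * S"
    using \<kappa>(2) S by (rule mult_right_mono)
  ultimately have "(X - D + S)\<^sup>2 + 2 * (X - D + S) * \<Phi>'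
    \<le> (X\<^sup>2 + 2 * X * \<Phi>) + X * (2 * S - (2 - 4 * \<kappa>) * D) + S\<^sup>2 + 5 * S + 1"
    using D \<Phi> \<kappa> S by (auto simp: power2_eq_square algebra_simps)
  then show ?thesis
    unfolding lyapunov_def X' \<Phi>'_def[symmetric] \<Phi>_def[symmetric] X_def[symmetric] .
qed

text \<open>
  At a switch the two announced idle slots move up: the second one becomes the first, and the new
  second one is at least the whole backlog away, so that its price is bounded. The price
  of the present idle slot is refunded.
\<close>
lemma lyapunov_switch:
  fixes A :: "2 \<Rightarrow> nat" and c :: channels and s :: state
  assumes \<kappa>: "0 < \<kappa>"
  defines "S \<equiv> real (\<Sum>i\<in>UNIV. A i)" and "s' \<equiv> step s c False A"
  shows "lyapunov \<kappa> (qlen s' (loc s')) s'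
    \<le> lyapunov \<kappa> 0 s + real (backlog s) * (2 * S - 2) + S\<^sup>2 + 5 * S + 2 / \<kappa>"
proof -
  define X where "X = real (backlog s)"
  define \<phi> where "\<phi> = imminence \<kappa> (qlen s (other (loc s)))"
  define \<Phi>' where "\<Phi>' = imminence \<kappa> (qlen s' (loc s')) +
    imminence \<kappa> (qlen s' (loc s') + qlen s' (other (loc s')))"
  have S: "0 \<le> S" by (simp add: S_def del: of_nat_sum)
  have X': "real (backlog s') = X + S" by (simp add: X_def S_def s'_def backlog_step_switch)
  have "qlen s (other (loc s)) \<le> qlen s' (loc s')"
    "backlog s \<le> qlen s' (loc s') + qlen s' (other (loc s'))"
    by (auto simp: s'_def step_def service_def backlog_def two_queues[where i="loc s"])
  then have le: "\<Phi>' \<le> \<phi> + imminence \<kappa> (backlog s)"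
    unfolding \<Phi>'_def \<phi>_def by (intro add_mono imminence_antimono \<kappa>)
  then have "X * \<Phi>' \<le> X * (\<phi> + imminence \<kappa> (backlog s))"
    by (intro mult_left_mono) (auto simp: X_def)
  also have "\<dots> \<le> X * \<phi> + 1 / \<kappa>"
    using imminence_bounds(4)[OF \<kappa>, of "backlog s"] by (simp add: X_def algebra_simps)
  finally have 1: "X * \<Phi>' \<le> X * \<phi> + 1 / \<kappa>" .
  have "\<Phi>' \<le> 2"
    using imminence_bounds(2)[OF \<kappa>, of "qlen s' (loc s')"]
      imminence_bounds(2)[OF \<kappa>, of "qlen s' (loc s') + qlen s' (other (loc s'))"]
    unfolding \<Phi>'_def by linarith
  then have 2: "S * \<Phi>' \<le> S * 2" using S by (rule mult_left_mono)
  have "(X + S)\<^sup>2 + 2 * (X + S) * \<Phi>'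
    \<le> (X\<^sup>2 + 2 * X * (1 + \<phi>)) + X * (2 * S - 2) + S\<^sup>2 + 5 * S + 2 / \<kappa>"
    using 1 2 S by (auto simp: power2_eq_square algebra_simps)
  then show ?thesis
    unfolding lyapunov_def X' \<Phi>'_def[symmetric]
    using imminence_bounds(3)[OF \<kappa>] by (simp add: \<phi>_def X_def)
qed

section \<open>Integrals over the random inputs of a slot\<close>

definition arrivals :: "(2 \<Rightarrow> nat pmf) \<Rightarrow> nat pmf" where
  "arrivals arr = map_pmf (\<lambda>A. \<Sum>i\<in>UNIV. A i) (Pi_pmf UNIV 0 arr)"

lemma arrival_law_integrable:
  assumes "arrival_law x p"
  shows "integrable (measure_pmf p) real"
  by (rule measure_pmf.square_integrable_imp_integrable) (use assms in \<open>auto simp: arrival_law_def\<close>)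

lemma arrival_law_arrivals:
  assumes "\<And>i. arrival_law (r i) (arr i)"
  shows "arrival_law (r 1 + r 2) (arrivals arr)"
proof -
  let ?P = "Pi_pmf UNIV 0 arr"
  have comp: "map_pmf (\<lambda>A. A i) ?P = arr i" for i
    by (simp add: Pi_pmf_component)
  have sq: "integrable ?P (\<lambda>A. (real (A i))\<^sup>2)" for i
    using assms[of i] unfolding arrival_law_def comp[of i, symmetric] by simp
  have int: "integrable ?P (\<lambda>A. real (A i))" for i
    using arrival_law_integrable[OF assms[of i]] unfolding comp[of i, symmetric] by simp
  have mean: "measure_pmf.expectation ?P (\<lambda>A. real (A i)) = r i" for i
    using assms[of i] unfolding arrival_law_def comp[of i, symmetric] by simp
  have "integrable ?P (\<lambda>A. 2 * (real (A 1))\<^sup>2 + 2 * (real (A 2))\<^sup>2)"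
    by (intro Bochner_Integration.integrable_add integrable_mult_right sq)
  then have "integrable ?P (\<lambda>A. (real (A 1) + real (A 2))\<^sup>2)"
  proof (rule Bochner_Integration.integrable_bound)
    have "(a + b)\<^sup>2 \<le> 2 * a\<^sup>2 + 2 * b\<^sup>2" for a b :: real
      using sum_squares_bound[of a b] by (simp add: power2_sum)
    then show "AE A in ?P. norm ((real (A 1) + real (A 2))\<^sup>2) \<le> norm (2 * (real (A 1))\<^sup>2 + 2 * (real (A 2))\<^sup>2)"
      by simp
  qed simp
  then show ?thesis
    using mean int by (simp add: arrival_law_def arrivals_def sum_2)
qed

lemma nn_integral_quadratic:
  assumes "arrival_law x p" and "\<And>k. 0 \<le> a + b * real k + (real k)\<^sup>2"
  shows "(\<integral>\<^sup>+ k. ennreal (a + b * real k + (real k)\<^sup>2) \<partial>measure_pmf p)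
    = ennreal (a + b * x + measure_pmf.expectation p (\<lambda>k. (real k)\<^sup>2))"
  using assms arrival_law_integrable[OF assms(1)]
  by (subst nn_integral_eq_integral) (auto simp: arrival_law_def)

lemma nn_integral_fair_coin:
  assumes "\<And>b. 0 \<le> f b"
  shows "(\<integral>\<^sup>+ b. ennreal (f b) \<partial>bernoulli_pmf (1 / 2)) = ennreal ((f True + f False) / 2)"
  using assms
  by (subst nn_integral_eq_integral) (auto intro!: integrable_measure_pmf_finite simp: add_divide_distrib)

section \<open>Budgeted visits\<close>

text \<open>
  The common pattern of the two policies. The inequality \<open>w h s \<le> qlen s (loc s)\<close> is only an
  invariant: it need not hold for a past \<open>h\<close> that is incompatible with \<open>s\<close>, and the conditions
  require just that it holds initially and is preserved. It ensures that a slot in which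
  the server stays with an ON channel is not wasted on an empty queue.
\<close>
definition follows_budget :: "policy \<Rightarrow> (past \<Rightarrow> state \<Rightarrow> nat) \<Rightarrow> bool" where
  "follows_budget \<pi> w \<longleftrightarrow>
     (\<forall>h s c. \<pi> h s c = return_pmf (0 < w h s)) \<and>
     (\<forall>s. w [] s \<le> qlen s (loc s)) \<and>
     (\<forall>h s c A. w h s \<le> qlen s (loc s) \<longrightarrow>
        (let s' = step s c True A; b = w ((s, c, True) # h) s'
         in w h s - service s c True (loc s) \<le> b \<and> b \<le> qlen s' (loc s'))) \<and>
     (\<forall>h s c s'. w ((s, c, False) # h) s' = qlen s' (loc s'))"

lemma follows_budget_exhaustive: "follows_budget exhaustive (\<lambda>h s. qlen s (loc s))"
  by (auto simp: follows_budget_def exhaustive_def step_def)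

lemma follows_budget_gated: "follows_budget gated gate"
  by (auto simp: follows_budget_def gated_def step_def service_def)

lemma budget_le_qlen:
  assumes "follows_budget \<pi> w" and "(h, s) \<in> set_pmf (trajectory arr ch m0 \<pi> t)"
  shows "w h s \<le> qlen s (loc s)"
  using assms(2)
proof (induction t arbitrary: h s)
  case 0
  have "w [] s \<le> qlen s (loc s)" using assms(1) unfolding follows_budget_def by blast
  then show ?case using 0 by simp
next
  case (Suc t)
  then obtain h' s' c a A where *: "(h', s') \<in> set_pmf (trajectory arr ch m0 \<pi> t)"
    "h = (s', c, a) # h'" "s = step s' c a A"
    by auto
  then show ?case
    using Suc.IH[OF *(1)] assms(1) by (cases a) (auto simp: follows_budget_def Let_def)
qed

section \<open>Stability below rate one half\<close>

text \<open>
  The drift is written without subtraction since the integrals take values in \<open>ennreal\<close>. Staying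
  and switching share the bound \<open>X * (2 * S - d) + S\<^sup>2 + 5 * S + 2 / \<kappa>\<close> on the increment, where \<open>S\<close> is the
  number of arrivals and \<open>d\<close> is \<open>2\<close> for a switch, and \<open>2 - 4 * \<kappa>\<close> or \<open>0\<close> for a stay, depending on
  the channel. So the arrivals are integrated once for arbitrary \<open>d\<close>, and the mean of \<open>d\<close>, at least
  \<open>1 - 2 * \<kappa> = 1 - \<delta>\<close>, exceeds \<open>2 * lam = 1 - 2 * \<delta>\<close> by at least \<open>\<delta>\<close>.
\<close>
lemma lyapunov_drift:
  fixes arr :: "2 \<Rightarrow> nat pmf" and lam :: real
  assumes law: "arrival_law lam (arrivals arr)" and "lam < 1 / 2"
    and ch: "\<And>i. ch i = bernoulli_pmf (1 / 2)"
    and w: "follows_budget \<pi> w" and le: "w h s \<le> qlen s (loc s)"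
  defines "\<delta> \<equiv> 1 / 2 - lam"
  defines "M \<equiv> measure_pmf.expectation (arrivals arr) (\<lambda>k. (real k)\<^sup>2) + 5 * lam + 4 / \<delta>"
  shows "(\<integral>\<^sup>+ c. \<integral>\<^sup>+ a. \<integral>\<^sup>+ A. ennreal (lyapunov (\<delta> / 2) (w ((s, c, a) # h) (step s c a A)) (step s c a A))
        \<partial>Pi_pmf UNIV 0 arr \<partial>\<pi> h s c \<partial>Pi_pmf UNIV False ch) + ennreal \<delta> * of_nat (backlog s)
     \<le> ennreal (lyapunov (\<delta> / 2) (w h s) s) + ennreal M" (is "?L + _ \<le> _")
proof -
  define \<kappa> where "\<kappa> = \<delta> / 2"
  define m where "m = measure_pmf.expectation (arrivals arr) (\<lambda>k. (real k)\<^sup>2)"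
  define V where "V = lyapunov \<kappa> (w h s) s"
  define X where "X = real (backlog s)"
  have lam: "0 \<le> lam" using law by (auto simp: arrival_law_def)
  have \<delta>: "0 < \<delta>" "\<delta> \<le> 1 / 2" using lam \<open>lam < 1 / 2\<close> by (auto simp: \<delta>_def)
  then have \<kappa>: "0 < \<kappa>" "\<kappa> \<le> 1 / 4" by (auto simp: \<kappa>_def)
  have m: "0 \<le> m" by (simp add: m_def)
  have X: "0 \<le> X" by (simp add: X_def)
  have M: "M = m + 5 * lam + 2 / \<kappa>" by (simp add: M_def m_def \<kappa>_def)
  let ?V' = "\<lambda>c a A. lyapunov \<kappa> (w ((s, c, a) # h) (step s c a A)) (step s c a A)"
  have slot: "(\<integral>\<^sup>+ A. ennreal (?V' c a A) \<partial>Pi_pmf UNIV 0 arr) \<le> ennreal (V + X * (2 * lam - d) + M)"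
    "0 \<le> V + X * (2 * lam - d) + M"
    if bound: "\<And>A. ?V' c a A \<le> V + X * (2 * real (\<Sum>i\<in>UNIV. A i) - d)
      + (real (\<Sum>i\<in>UNIV. A i))\<^sup>2 + 5 * real (\<Sum>i\<in>UNIV. A i) + 2 / \<kappa>" for c a d
  proof -
    let ?q = "\<lambda>k. (V - X * d + 2 / \<kappa>) + (2 * X + 5) * real k + (real k)\<^sup>2"
    have q: "?V' c a A \<le> ?q (\<Sum>i\<in>UNIV. A i)" for A
      using bound[of A] by (simp add: algebra_simps)
    \<comment> \<open>The value of \<open>?q\<close> without arrivals dominates a nonnegative Lyapunov value.\<close>
    have "0 \<le> V - X * d + 2 / \<kappa>"
      using order_trans[OF lyapunov_nonneg[OF \<kappa>(1)] q[of "\<lambda>_. 0"]] by simp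
    then have pos: "0 \<le> ?q k" for k using X by simp
    have "(\<integral>\<^sup>+ A. ennreal (?V' c a A) \<partial>Pi_pmf UNIV 0 arr)
      \<le> (\<integral>\<^sup>+ A. ennreal (?q (\<Sum>i\<in>UNIV. A i)) \<partial>Pi_pmf UNIV 0 arr)"
      by (intro nn_integral_mono ennreal_leI q)
    also have "\<dots> = (\<integral>\<^sup>+ k. ennreal (?q k) \<partial>arrivals arr)"
      by (simp add: arrivals_def)
    also have "\<dots> = ennreal (V + X * (2 * lam - d) + M)"
      by (subst nn_integral_quadratic[OF law pos]) (simp add: M m_def algebra_simps)
    finally show "(\<integral>\<^sup>+ A. ennreal (?V' c a A) \<partial>Pi_pmf UNIV 0 arr) \<le> \<dots>" .
    show "0 \<le> V + X * (2 * lam - d) + M"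
      using \<open>0 \<le> V - X * d + 2 / \<kappa>\<close> m lam mult_nonneg_nonneg[OF X lam] by (simp add: M algebra_simps)
  qed
  have "?L \<le> ennreal (V + M - \<delta> * X)" and "0 \<le> V + M - \<delta> * X"
  proof -
    show "?L \<le> ennreal (V + M - \<delta> * X)"
    proof (cases "0 < w h s")
      case True
      define d where "d = (\<lambda>b. (2 - 4 * \<kappa>) * of_bool b)"
      have bound: "?V' c True A \<le> V + X * (2 * real (\<Sum>i\<in>UNIV. A i) - d (c (loc s)))
        + (real (\<Sum>i\<in>UNIV. A i))\<^sup>2 + 5 * real (\<Sum>i\<in>UNIV. A i) + 2 / \<kappa>" for c A
      proof -
        have "1 \<le> 2 / \<kappa>" using \<kappa> by simp
        moreover have "w h s - service s c True (loc s) \<le> w ((s, c, True) # h) (step s c True A)"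
          using w le by (auto simp: follows_budget_def Let_def)
        ultimately show ?thesis
          using lyapunov_stay[OF \<kappa> True le, of c _ A] by (fastforce simp: V_def X_def d_def)
      qed
      have pos: "0 \<le> V + X * (2 * lam - d b) + M" for b
        using slot(2)[OF bound, of "\<lambda>_. b"] by simp
      have "?L \<le> (\<integral>\<^sup>+ c. ennreal (V + X * (2 * lam - d (c (loc s))) + M) \<partial>Pi_pmf UNIV False ch)"
        using True w slot(1)[OF bound]
        by (intro nn_integral_mono) (simp add: follows_budget_def \<kappa>_def)
      also have "\<dots> = (\<integral>\<^sup>+ b. ennreal (V + X * (2 * lam - d b) + M)
          \<partial>map_pmf (\<lambda>c. c (loc s)) (Pi_pmf UNIV False ch))"
        by simp
      also have "map_pmf (\<lambda>c. c (loc s)) (Pi_pmf UNIV False ch) = bernoulli_pmf (1 / 2)"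
        by (simp add: Pi_pmf_component ch)
      also have "(\<integral>\<^sup>+ b. ennreal (V + X * (2 * lam - d b) + M) \<partial>bernoulli_pmf (1 / 2)) =
        ennreal (((V + X * (2 * lam - d True) + M) + (V + X * (2 * lam - d False) + M)) / 2)"
        by (rule nn_integral_fair_coin) (rule pos)
      also have "\<dots> = ennreal (V + M - \<delta> * X)"
        by (simp add: d_def \<kappa>_def \<delta>_def field_simps)
      finally show ?thesis .
    next
      case False
      have bound: "?V' c False A \<le> V + X * (2 * real (\<Sum>i\<in>UNIV. A i) - 2)
        + (real (\<Sum>i\<in>UNIV. A i))\<^sup>2 + 5 * real (\<Sum>i\<in>UNIV. A i) + 2 / \<kappa>" for c A
        using lyapunov_switch[OF \<kappa>(1), of s c A] w False by (simp add: follows_budget_def V_def X_def)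
      have "?L \<le> (\<integral>\<^sup>+ c. ennreal (V + X * (2 * lam - 2) + M) \<partial>Pi_pmf UNIV False ch)"
        using False w slot(1)[OF bound]
        by (intro nn_integral_mono) (simp add: follows_budget_def \<kappa>_def)
      also have "\<dots> = ennreal (V + X * (2 * lam - 2) + M)"
        by simp
      also have "\<dots> \<le> ennreal (V + M - \<delta> * X)"
      proof (rule ennreal_leI)
        have "X * (2 * lam - 2) \<le> X * (- \<delta>)"
          using X \<open>lam < 1 / 2\<close> by (intro mult_left_mono) (auto simp: \<delta>_def)
        then show "V + X * (2 * lam - 2) + M \<le> V + M - \<delta> * X" by (simp add: algebra_simps)
      qed
      finally show ?thesis .
    qed
    \<comment> \<open>As \<open>ennreal\<close> cuts negative numbers off at zero, adding \<open>\<delta> * X\<close> back needs this sign.\<close>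
    have "\<delta> * X \<le> X\<^sup>2 + 1"
    proof -
      have "\<delta> * X \<le> 1 * X" using \<delta> X by (intro mult_right_mono) auto
      also have "\<dots> \<le> X\<^sup>2 + 1" using sum_squares_bound[of X 1] X by simp
      finally show ?thesis .
    qed
    moreover have "X\<^sup>2 \<le> V"
      using imminence_bounds(1)[OF \<kappa>(1)] by (simp add: V_def X_def lyapunov_def)
    moreover have "1 \<le> 2 / \<kappa>" using \<kappa> by simp
    ultimately show "0 \<le> V + M - \<delta> * X" using m lam unfolding M by linarith
  qed
  then have "?L + ennreal \<delta> * of_nat (backlog s) \<le> ennreal (V + M - \<delta> * X) + ennreal (\<delta> * X)"
    using \<delta> X by (intro add_mono) (auto simp: X_def ennreal_mult ennreal_of_nat_eq_real_of_nat)
  also have "\<dots> = ennreal (V + M)"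
    using \<open>0 \<le> V + M - \<delta> * X\<close> \<delta> X by (simp flip: ennreal_plus)
  also have "\<dots> = ennreal V + ennreal M"
    using lyapunov_nonneg[OF \<kappa>(1)] m lam \<kappa> by (simp add: V_def M)
  finally show ?thesis unfolding V_def \<kappa>_def .
qed

lemma sum_mean_qlen:
  "(\<Sum>i\<in>UNIV. mean_qlen arr ch m0 \<pi> t i)
    = (\<integral>\<^sup>+ x. of_nat (backlog (snd x)) \<partial>trajectory arr ch m0 \<pi> t)"
  by (simp add: mean_qlen_def backlog_def sum_2 nn_integral_add)

text \<open>Telescoping the drift from the empty system, where the Lyapunov function vanishes.\<close>
lemma stabilizes_if_follows_budget:
  assumes law: "arrival_law lam (arrivals arr)" and lam: "lam < 1 / 2"
    and ch: "\<And>i. ch i = bernoulli_pmf (1 / 2)" and w: "follows_budget \<pi> w"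
  shows "stabilizes arr ch m0 \<pi>"
proof -
  define \<delta> where "\<delta> = 1 / 2 - lam"
  define M where "M = measure_pmf.expectation (arrivals arr) (\<lambda>k. (real k)\<^sup>2) + 5 * lam + 4 / \<delta>"
  let ?T = "trajectory arr ch m0 \<pi>"
  define V where "V = (\<lambda>t. \<integral>\<^sup>+ (h, s). ennreal (lyapunov (\<delta> / 2) (w h s) s) \<partial>?T t)"
  define X where "X = (\<lambda>t. \<Sum>i\<in>UNIV. mean_qlen arr ch m0 \<pi> t i)"
  have \<delta>: "0 < \<delta>" using lam by (simp add: \<delta>_def)
  have "0 \<le> lam" using law by (auto simp: arrival_law_def)
  then have M: "0 \<le> M" using \<delta> by (simp add: M_def)
  have drift: "V (Suc t) + ennreal \<delta> * X t \<le> V t + ennreal M" for t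
  proof -
    let ?next = "\<lambda>h s. \<integral>\<^sup>+ c. \<integral>\<^sup>+ a. \<integral>\<^sup>+ A. ennreal (lyapunov (\<delta> / 2) (w ((s, c, a) # h) (step s c a A)) (step s c a A))
        \<partial>Pi_pmf UNIV 0 arr \<partial>\<pi> h s c \<partial>Pi_pmf UNIV False ch"
    have "V (Suc t) + ennreal \<delta> * X t =
      (\<integral>\<^sup>+ (h, s). ?next h s + ennreal \<delta> * of_nat (backlog s) \<partial>?T t)"
      by (simp add: V_def X_def sum_mean_qlen case_prod_unfold nn_integral_add nn_integral_cmult)
    also have "\<dots> \<le> (\<integral>\<^sup>+ (h, s). ennreal (lyapunov (\<delta> / 2) (w h s) s) + ennreal M \<partial>?T t)"
    proof (rule nn_integral_mono_AE, rule AE_pmfI)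
      fix x assume "x \<in> set_pmf (?T t)"
      then have "w (fst x) (snd x) \<le> qlen (snd x) (loc (snd x))"
        using budget_le_qlen[OF w, of "fst x" "snd x"] by simp
      from lyapunov_drift[OF law lam ch w this]
      show "(case x of (h, s) \<Rightarrow> ?next h s + ennreal \<delta> * of_nat (backlog s))
        \<le> (case x of (h, s) \<Rightarrow> ennreal (lyapunov (\<delta> / 2) (w h s) s) + ennreal M)"
        by (simp add: case_prod_unfold \<delta>_def M_def)
    qed
    also have "\<dots> = V t + ennreal M"
      by (simp add: V_def case_prod_unfold nn_integral_add)
    finally show ?thesis .
  qed
  have "V t + ennreal \<delta> * (\<Sum>\<tau><t. X \<tau>) \<le> of_nat t * ennreal M" for t
  proof (induction t)
    case 0
    then show ?case by (simp add: V_def lyapunov_def backlog_def)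
  next
    case (Suc t)
    have "V (Suc t) + ennreal \<delta> * (\<Sum>\<tau><Suc t. X \<tau>)
      = (V (Suc t) + ennreal \<delta> * X t) + ennreal \<delta> * (\<Sum>\<tau><t. X \<tau>)"
      by (simp add: algebra_simps)
    also have "\<dots> \<le> (V t + ennreal \<delta> * (\<Sum>\<tau><t. X \<tau>)) + ennreal M"
      using add_right_mono[OF drift[of t]] by (simp add: algebra_simps)
    also have "\<dots> \<le> of_nat t * ennreal M + ennreal M"
      by (rule add_right_mono[OF Suc.IH])
    also have "\<dots> = of_nat (Suc t) * ennreal M"
      by (simp add: algebra_simps)
    finally show ?case .
  qed
  then have sum: "ennreal \<delta> * (\<Sum>\<tau><t. X \<tau>) \<le> of_nat t * ennreal M" for t
    by (rule order_trans[rotated]) simp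
  have "(\<Sum>\<tau><t. X \<tau>) / of_nat t \<le> ennreal (M / \<delta>)" if "0 < t" for t
  proof -
    have "(\<Sum>\<tau><t. X \<tau>) = ennreal (1 / \<delta>) * (ennreal \<delta> * (\<Sum>\<tau><t. X \<tau>))"
      using \<delta> by (simp add: mult.assoc[symmetric] flip: ennreal_mult)
    also have "\<dots> \<le> ennreal (1 / \<delta>) * (of_nat t * ennreal M)"
      by (intro mult_left_mono sum) simp
    also have "\<dots> = ennreal (M / \<delta>) * of_nat t"
      using \<delta> M by (simp add: ennreal_of_nat_eq_real_of_nat mult.commute flip: ennreal_mult)
    finally show ?thesis using that by (simp add: divide_le_posI_ennreal mult.commute)
  qed
  then have "limsup (\<lambda>t. (\<Sum>\<tau><t. X \<tau>) / of_nat t) \<le> ennreal (M / \<delta>)"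
    by (intro Limsup_bounded eventually_mono[OF eventually_gt_at_top[of 0]]) auto
  then show ?thesis
    unfolding stabilizes_def X_def using order_le_less_trans by fastforce
qed

section \<open>Instability above rate one half\<close>

text \<open>
  The channels of a slot are independent of the state, so the server sees an ON channel with
  probability exactly \<open>1 / 2\<close>, and \<open>backlog_step_ge\<close> makes the mean backlog grow by
  \<open>lam - 1 / 2\<close> or more in every slot. The time average then grows at least at half that rate.
\<close>
lemma not_stabilizes_if_overloaded:
  assumes law: "arrival_law lam (arrivals arr)" and lam: "1 / 2 < lam"
    and ch: "\<And>i. ch i = bernoulli_pmf (1 / 2)"
  shows "\<not> stabilizes arr ch m0 \<pi>"
proof
  assume st: "stabilizes arr ch m0 \<pi>"
  let ?T = "trajectory arr ch m0 \<pi>"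
  define X where "X = (\<lambda>t. \<Sum>i\<in>UNIV. mean_qlen arr ch m0 \<pi> t i)"
  define \<epsilon> where "\<epsilon> = lam - 1 / 2"
  have \<epsilon>: "0 < \<epsilon>" using lam by (simp add: \<epsilon>_def)
  have mean: "(\<integral>\<^sup>+ A. of_nat (\<Sum>i\<in>UNIV. A i) \<partial>Pi_pmf UNIV 0 arr) = ennreal lam"
  proof -
    have "(\<integral>\<^sup>+ A. of_nat (\<Sum>i\<in>UNIV. A i) \<partial>Pi_pmf UNIV 0 arr) = (\<integral>\<^sup>+ k. ennreal (real k) \<partial>arrivals arr)"
      by (simp add: arrivals_def ennreal_of_nat_eq_real_of_nat del: of_nat_sum)
    also have "\<dots> = ennreal lam"
      using law arrival_law_integrable[OF law]
      by (subst nn_integral_eq_integral) (auto simp: arrival_law_def)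
    finally show ?thesis .
  qed
  have on: "(\<integral>\<^sup>+ c. of_bool (c i) \<partial>Pi_pmf UNIV False ch) = ennreal (1 / 2)" for i
  proof -
    have "(\<integral>\<^sup>+ c. of_bool (c i) \<partial>Pi_pmf UNIV False ch)
      = (\<integral>\<^sup>+ b. of_bool b \<partial>map_pmf (\<lambda>c. c i) (Pi_pmf UNIV False ch))"
      by simp
    also have "\<dots> = ennreal (1 / 2)"
      by (subst Pi_pmf_component) (simp_all add: ch)
    finally show ?thesis .
  qed
  have growth: "X t + ennreal lam \<le> X (Suc t) + ennreal (1 / 2)" for t
  proof -
    let ?next = "\<lambda>h s. \<integral>\<^sup>+ c. \<integral>\<^sup>+ a. \<integral>\<^sup>+ A. of_nat (backlog (step s c a A))
        \<partial>Pi_pmf UNIV 0 arr \<partial>\<pi> h s c \<partial>Pi_pmf UNIV False ch"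
    have "of_nat (backlog s) + ennreal lam \<le> ?next h s + ennreal (1 / 2)" for h s
    proof -
      have "of_nat (backlog s) + ennreal lam = (\<integral>\<^sup>+ c. \<integral>\<^sup>+ a. \<integral>\<^sup>+ A. of_nat (backlog s + (\<Sum>i\<in>UNIV. A i))
        \<partial>Pi_pmf UNIV 0 arr \<partial>\<pi> h s c \<partial>Pi_pmf UNIV False ch)"
        using mean by (simp add: nn_integral_add del: of_nat_sum)
      also have "\<dots> \<le> (\<integral>\<^sup>+ c. \<integral>\<^sup>+ a. \<integral>\<^sup>+ A. of_nat (backlog (step s c a A) + of_bool (c (loc s)))
        \<partial>Pi_pmf UNIV 0 arr \<partial>\<pi> h s c \<partial>Pi_pmf UNIV False ch)"
        by (intro nn_integral_mono of_nat_mono backlog_step_ge)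
      also have "\<dots> = ?next h s + ennreal (1 / 2)"
        using on by (simp add: nn_integral_add del: of_nat_sum)
      finally show ?thesis .
    qed
    then have "(\<integral>\<^sup>+ (h, s). of_nat (backlog s) + ennreal lam \<partial>?T t)
      \<le> (\<integral>\<^sup>+ (h, s). ?next h s + ennreal (1 / 2) \<partial>?T t)"
      by (intro nn_integral_mono) (simp add: case_prod_unfold)
    then show ?thesis
      by (simp add: X_def sum_mean_qlen case_prod_unfold nn_integral_add)
  qed
  \<comment> \<open>Induction in the form \<open>1 / 2 + _ \<le> 1 / 2 + _\<close>, since a finite summand can be cancelled in \<open>ennreal\<close>.\<close>
  have lower: "ennreal (\<epsilon> * real t) \<le> X t" for t
  proof (induction t)
    case (Suc t)
    have "ennreal (\<epsilon> * real (Suc t)) + ennreal (1 / 2) = ennreal (\<epsilon> * real (Suc t) + 1 / 2)"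
      using \<epsilon> by (intro ennreal_plus[symmetric]) auto
    also have "\<epsilon> * real (Suc t) + 1 / 2 = \<epsilon> * real t + lam"
      by (simp add: \<epsilon>_def algebra_simps)
    also have "ennreal (\<epsilon> * real t + lam) = ennreal (\<epsilon> * real t) + ennreal lam"
      using \<epsilon> lam by (intro ennreal_plus) auto
    also have "\<dots> \<le> X t + ennreal lam" by (rule add_right_mono[OF Suc])
    also have "\<dots> \<le> X (Suc t) + ennreal (1 / 2)" by (rule growth)
    finally have "ennreal (1 / 2) + ennreal (\<epsilon> * real (Suc t)) \<le> ennreal (1 / 2) + X (Suc t)"
      by (simp only: add.commute)
    then show ?case
      unfolding ennreal_add_left_cancel_le using ennreal_neq_top[of "1 / 2"] by auto
  qed simp
  have average: "ennreal (\<epsilon> * (real t - 1) / 2) \<le> (\<Sum>\<tau><t. X \<tau>) / of_nat t" if "0 < t" for t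
  proof -
    have "2 * (\<Sum>\<tau><t. real \<tau>) = real t * (real t - 1)"
      by (induction t) (auto simp: algebra_simps)
    then have gauss: "(\<Sum>\<tau><t. real \<tau>) = real t * (real t - 1) / 2"
      by linarith
    have "(\<Sum>\<tau><t. \<epsilon> * real \<tau>) = \<epsilon> * (\<Sum>\<tau><t. real \<tau>)"
      by (rule sum_distrib_left[symmetric])
    then have "(\<Sum>\<tau><t. \<epsilon> * real \<tau>) = \<epsilon> * (real t - 1) / 2 * real t"
      unfolding gauss by simp
    then have "\<epsilon> * (real t - 1) / 2 = (\<Sum>\<tau><t. \<epsilon> * real \<tau>) / real t"
      using that by simp
    then have "ennreal (\<epsilon> * (real t - 1) / 2) = ennreal (\<Sum>\<tau><t. \<epsilon> * real \<tau>) / of_nat t"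
      using that \<epsilon> by (simp add: ennreal_of_nat_eq_real_of_nat divide_ennreal sum_nonneg)
    also have "ennreal (\<Sum>\<tau><t. \<epsilon> * real \<tau>) = (\<Sum>\<tau><t. ennreal (\<epsilon> * real \<tau>))"
      using \<epsilon> by (intro sum_ennreal[symmetric]) simp
    also have "(\<Sum>\<tau><t. ennreal (\<epsilon> * real \<tau>)) / of_nat t \<le> (\<Sum>\<tau><t. X \<tau>) / of_nat t"
      by (intro divide_right_mono_ennreal sum_mono lower)
    finally show ?thesis .
  qed
  obtain b where b: "limsup (\<lambda>t. (\<Sum>\<tau><t. X \<tau>) / of_nat t) < b" "b < \<infinity>"
    using st dense unfolding stabilizes_def X_def by blast
  then obtain B where B: "b = ennreal B" "0 \<le> B" by (cases b) auto
  from Limsup_lessD[OF b(1)] obtain N where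
    N: "\<And>t. N \<le> t \<Longrightarrow> (\<Sum>\<tau><t. X \<tau>) / of_nat t < ennreal B"
    by (auto simp: B eventually_sequentially)
  obtain n where n: "2 * B / \<epsilon> < real n" using reals_Archimedean2 by blast
  define t where "t = Suc (max N n)"
  have "ennreal (\<epsilon> * (real t - 1) / 2) < ennreal B"
    using order_le_less_trans[OF average N, of t] by (simp add: t_def)
  moreover have "B \<le> \<epsilon> * (real t - 1) / 2"
  proof -
    have "\<epsilon> * real n \<le> \<epsilon> * (real t - 1)"
      using \<epsilon> by (intro mult_left_mono) (auto simp: t_def)
    then show ?thesis using n \<epsilon> by (simp add: field_simps)
  qed
  ultimately show False using B by (simp add: ennreal_less_iff leD)
qed

section \<open>The stability region\<close>

theorem theorem1:
  fixes F :: "real ^ 2 \<Rightarrow> 2 \<Rightarrow> nat pmf"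
    and ch :: "2 \<Rightarrow> bool pmf"
    and m0 :: 2
  assumes "arrival_model F"
    and "\<And>i. ch i = bernoulli_pmf (1 / 2)"
  shows "stability_region F ch m0 = {r. r $ 1 + r $ 2 \<le> 1 / 2 \<and> 0 \<le> r $ 1 \<and> 0 \<le> r $ 2}
    \<and> throughput_optimal F ch m0 exhaustive
    \<and> throughput_optimal F ch m0 gated"
proof -
  let ?\<Lambda> = "{r :: real ^ 2. r $ 1 + r $ 2 \<le> 1 / 2 \<and> 0 \<le> r $ 1 \<and> 0 \<le> r $ 2}"
  let ?S = "{r. (\<forall>i. 0 \<le> r $ i) \<and> (\<exists>\<pi>. stabilizes (F r) ch m0 \<pi>)}"
  have law: "arrival_law (r $ 1 + r $ 2) (arrivals (F r))" if "\<forall>i. 0 \<le> r $ i" for r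
    using assms(1) that by (intro arrival_law_arrivals) (simp add: arrival_model_def)
  have stable: "stabilizes (F (\<rho> *\<^sub>R r)) ch m0 \<pi>"
    if "r \<in> ?\<Lambda>" "0 \<le> \<rho>" "\<rho> < 1" "follows_budget \<pi> w" for \<rho> r \<pi> w
  proof (rule stabilizes_if_follows_budget[OF law _ assms(2) that(4)])
    have "\<rho> * (r $ 1 + r $ 2) \<le> \<rho> * (1 / 2)"
      using that by (intro mult_left_mono) auto
    then show "(\<rho> *\<^sub>R r) $ 1 + (\<rho> *\<^sub>R r) $ 2 < 1 / 2"
      using that by (simp add: algebra_simps)
  qed (use that in \<open>auto simp: forall_2\<close>)
  have region: "stability_region F ch m0 = ?\<Lambda>"
    unfolding stability_region_def
  proof
    have "closed ?\<Lambda>"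
      by (intro closed_Collect_conj closed_Collect_le continuous_intros)
    moreover have "?S \<subseteq> ?\<Lambda>"
      using not_stabilizes_if_overloaded[OF law _ assms(2)] by (fastforce simp: not_less[symmetric])
    ultimately show "closure ?S \<subseteq> ?\<Lambda>" by (rule closure_minimal[rotated])
    show "?\<Lambda> \<subseteq> closure ?S"
    proof
      fix r assume r: "r \<in> ?\<Lambda>"
      define \<rho> where "\<rho> = (\<lambda>n::nat. 1 - 1 / real (Suc n))"
      have "\<rho> \<longlonglongrightarrow> 1 - 0"
        unfolding \<rho>_def by (intro tendsto_diff tendsto_const LIMSEQ_Suc lim_1_over_n)
      then have "(\<lambda>n. \<rho> n *\<^sub>R r) \<longlonglongrightarrow> r"
        using tendsto_scaleR[of \<rho> 1 sequentially "\<lambda>_. r" r] by simp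
      moreover have "\<rho> n *\<^sub>R r \<in> ?S" for n
        using stable[OF r _ _ follows_budget_exhaustive, of "\<rho> n"] r
        by (auto simp: \<rho>_def forall_2)
      ultimately show "r \<in> closure ?S" unfolding closure_sequential
        by (intro exI[of _ "\<lambda>n. \<rho> n *\<^sub>R r"] conjI allI)
    qed
  qed
  moreover have "throughput_optimal F ch m0 \<pi>" if "follows_budget \<pi> w" for \<pi> w
    unfolding throughput_optimal_def region using stable that by blast
  ultimately show ?thesis
    using follows_budget_exhaustive follows_budget_gated by blast
qed

end
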